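(* Let $M$ be a complete non-compact metric space, and let $f\colon M\to M$ be a Lipschitz map. Assume that there are $x\in M$ and $r>0$ such that the closed ball $\overline{B}(x,r)$ is compact. Then, for every $e\in M$, the operator $T_{f,e}\colon\mathcal F(M,e)\to\mathcal F(M,e)$ admits a non-trivial invariant subspace.
   Context: $\mathbb K$ denotes $\mathbb R$ or $\mathbb C$. For a metric space $M$ and $e\in M$, $\mathrm{Lip}_0(M,e)$ is the Banach space of Lipschitz functions $\varphi\colon M\to\mathbb K$ with $\varphi(e)=0$, normed by the best Lipschitz constant. For $x\in M$, $\delta(x)=\delta_e(x)\in \mathrm{Lip}_0(M,e)^*$ is the evaluation functional $\varphi\mapsto\varphi(x)$. The Lipschitz-free space with basepoint $e$ is $\mathcal F(M,e):=\overline{\mathrm{span}}\{\delta(x):x\in M\}\subset \mathrm{Lip}_0(M,e)^*$ (norm closure). For a Lipschitz map $f\colon M\to M$ (not assumed to fix $e$), $T_{f,e}\colon\mathcal F(M,e)\to\mathcal F(M,e)$ is the unique bounded linear operator with $T_{f,e}(\delta(x))=\delta(f(x))-\delta(f(e))$ for all $x\in M$. A non-trivial invariant subspace of a bounded operator $T\colon X\to X$ is a closed linear subspace $S$ with $\{0\}\subsetneq S\subsetneq X$ and $T(S)\subset S$. Here $\overline{B}(x,r)=\{y\in M: d(x,y)\le r\}$. *)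

theory Defs
  imports "HOL-Analysis.Analysis" "HOL-Library.Function_Algebras"
begin

text \<open>
  The metric space \<open>M\<close> is a type \<open>'a\<close> and the scalar field is a type \<open>'k :: real_normed_field\<close>,
  to be instantiated with \<open>real\<close> and \<open>complex\<close>. Both Lipschitz functions \<open>'a \<Rightarrow> 'k\<close> and functionals
  \<open>('a \<Rightarrow> 'k) \<Rightarrow> 'k\<close> are \<open>'k\<close>-valued functions, added pointwise and scaled by \<open>fscale\<close>.
\<close>

definition fscale :: "'k::field \<Rightarrow> ('b \<Rightarrow> 'k) \<Rightarrow> ('b \<Rightarrow> 'k)"
  where "fscale c g = (\<lambda>t. c * g t)"

lemma fscale_apply [simp]: "fscale c g t = c * g t"
  by (simp add: fscale_def)

global_interpretation fvec: vector_space "fscale :: 'k::field \<Rightarrow> ('b \<Rightarrow> 'k) \<Rightarrow> ('b \<Rightarrow> 'k)"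
  by standard (auto simp: fun_eq_iff algebra_simps)

definition Lip0 :: "'a::metric_space \<Rightarrow> ('a \<Rightarrow> 'k::real_normed_field) set"
  where "Lip0 e = {\<phi>. (\<exists>C. C-lipschitz_on UNIV \<phi>) \<and> \<phi> e = 0}"

definition lip_norm :: "('a::metric_space \<Rightarrow> 'k::real_normed_field) \<Rightarrow> real"
  where "lip_norm \<phi> = Inf {C. C-lipschitz_on UNIV \<phi>}"

text \<open>
  Functionals on \<open>Lip0 e\<close> are represented by functions on all of \<open>'a \<Rightarrow> 'k\<close> that vanish
  outside \<open>Lip0 e\<close>, so that equal functionals are equal functions.
\<close>

definition lip_dual :: "'a::metric_space \<Rightarrow> (('a \<Rightarrow> 'k::real_normed_field) \<Rightarrow> 'k) set"
  where "lip_dual e = {F.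
    (\<forall>\<phi>\<in>Lip0 e. \<forall>\<psi>\<in>Lip0 e. F (\<phi> + \<psi>) = F \<phi> + F \<psi>) \<and>
    (\<forall>c. \<forall>\<phi>\<in>Lip0 e. F (fscale c \<phi>) = c * F \<phi>) \<and>
    (\<exists>C. \<forall>\<phi>\<in>Lip0 e. norm (F \<phi>) \<le> C * lip_norm \<phi>) \<and>
    (\<forall>\<phi>. \<phi> \<notin> Lip0 e \<longrightarrow> F \<phi> = 0)}"

text \<open>
  The guard gives \<open>dual_norm\<close> a non-negative value at functions that are not bounded functionals;
  \<open>Metric_space\<close> asks for a distance that is non-negative on the whole type.
\<close>

definition dual_norm :: "'a::metric_space \<Rightarrow> (('a \<Rightarrow> 'k::real_normed_field) \<Rightarrow> 'k) \<Rightarrow> real"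
  where "dual_norm e F =
    (if F \<in> lip_dual e then SUP \<phi>\<in>{\<phi>\<in>Lip0 e. lip_norm \<phi> \<le> 1}. norm (F \<phi>) else 0)"

definition dual_topology ::
    "'a::metric_space \<Rightarrow> (('a \<Rightarrow> 'k::real_normed_field) \<Rightarrow> 'k) topology"
  where "dual_topology e = Metric_space.mtopology (lip_dual e) (\<lambda>F G. dual_norm e (F - G))"

definition delta :: "'a::metric_space \<Rightarrow> 'a \<Rightarrow> ('a \<Rightarrow> 'k::real_normed_field) \<Rightarrow> 'k"
  where "delta e x = (\<lambda>\<phi>. if \<phi> \<in> Lip0 e then \<phi> x else 0)"

definition free_space :: "'a::metric_space \<Rightarrow> (('a \<Rightarrow> 'k::real_normed_field) \<Rightarrow> 'k) set"
  where "free_space e = dual_topology e closure_of fvec.span (range (delta e))"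

text \<open>Operators are normalised to be \<open>0\<close> outside \<open>free_space e\<close>.\<close>

definition bounded_operator :: "'a::metric_space \<Rightarrow>
    ((('a \<Rightarrow> 'k::real_normed_field) \<Rightarrow> 'k) \<Rightarrow> (('a \<Rightarrow> 'k) \<Rightarrow> 'k)) \<Rightarrow> bool"
  where "bounded_operator e T \<longleftrightarrow>
    T ` free_space e \<subseteq> free_space e \<and>
    (\<forall>F\<in>free_space e. \<forall>G\<in>free_space e. T (F + G) = T F + T G) \<and>
    (\<forall>c. \<forall>F\<in>free_space e. T (fscale c F) = fscale c (T F)) \<and>
    (\<exists>C. \<forall>F\<in>free_space e. dual_norm e (T F) \<le> C * dual_norm e F) \<and>
    (\<forall>F. F \<notin> free_space e \<longrightarrow> T F = 0)"

text \<open>For Lipschitz \<open>f\<close> this description is proved to be proper in \<open>free_operator_ex1\<close> below.\<close>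

definition free_operator :: "('a::metric_space \<Rightarrow> 'a) \<Rightarrow> 'a \<Rightarrow>
    (('a \<Rightarrow> 'k::real_normed_field) \<Rightarrow> 'k) \<Rightarrow> (('a \<Rightarrow> 'k) \<Rightarrow> 'k)"
  where "free_operator f e =
    (THE T. bounded_operator e T \<and> (\<forall>x. T (delta e x) = delta e (f x) - delta e (f e)))"

definition nontrivial_invariant_subspace :: "'a::metric_space \<Rightarrow>
    ((('a \<Rightarrow> 'k::real_normed_field) \<Rightarrow> 'k) \<Rightarrow> (('a \<Rightarrow> 'k) \<Rightarrow> 'k)) \<Rightarrow>
    (('a \<Rightarrow> 'k) \<Rightarrow> 'k) set \<Rightarrow> bool"
  where "nontrivial_invariant_subspace e T S \<longleftrightarrow>
    fvec.subspace S \<and> closedin (subtopology (dual_topology e) (free_space e)) S \<and>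
    {0} \<subset> S \<and> S \<subset> free_space e \<and> T ` S \<subseteq> S"


subsection \<open>Well-definedness\<close>

lemma lip_norm_le: "C-lipschitz_on UNIV \<phi> \<Longrightarrow> lip_norm \<phi> \<le> C"
  unfolding lip_norm_def
  by (rule cInf_lower) (auto intro!: bdd_belowI[of _ 0] simp: lipschitz_on_nonneg)

lemma lip_norm_lipschitz:
  assumes "\<phi> \<in> Lip0 e"
  shows "(lip_norm \<phi>)-lipschitz_on UNIV \<phi>"
proof (rule lipschitz_onI)
  have ne: "{C. C-lipschitz_on UNIV \<phi>} \<noteq> {}"
    using assms by (auto simp: Lip0_def)
  show "0 \<le> lip_norm \<phi>"
    unfolding lip_norm_def by (rule cInf_greatest[OF ne]) (auto simp: lipschitz_on_nonneg)
  fix x y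
  show "dist (\<phi> x) (\<phi> y) \<le> lip_norm \<phi> * dist x y"
  proof (cases "x = y")
    case False
    have "dist (\<phi> x) (\<phi> y) / dist x y \<le> lip_norm \<phi>"
      unfolding lip_norm_def
      by (rule cInf_greatest[OF ne]) (use False in \<open>auto simp: lipschitz_on_def divide_simps\<close>)
    then show ?thesis using False by (simp add: divide_simps)
  qed simp
qed

lemma lip_norm_nonneg: "\<phi> \<in> Lip0 e \<Longrightarrow> 0 \<le> lip_norm \<phi>"
  using lip_norm_lipschitz lipschitz_on_nonneg by blast

lemma Lip0_fscale:
  assumes "\<phi> \<in> Lip0 e"
  shows "fscale c \<phi> \<in> Lip0 e" "lip_norm (fscale c \<phi>) \<le> norm c * lip_norm \<phi>"
proof -
  have "(norm c * lip_norm \<phi>)-lipschitz_on UNIV (fscale c \<phi>)"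
    using lip_norm_lipschitz[OF assms] lip_norm_nonneg[OF assms]
    by (auto simp: lipschitz_on_def dist_norm right_diff_distrib[symmetric] norm_mult mult.assoc
        intro!: mult_left_mono)
  then show "fscale c \<phi> \<in> Lip0 e" "lip_norm (fscale c \<phi>) \<le> norm c * lip_norm \<phi>"
    using assms by (auto simp: Lip0_def intro: lip_norm_le)
qed

lemma Lip0_add:
  assumes "\<phi> \<in> Lip0 e" "\<psi> \<in> Lip0 e"
  shows "\<phi> + \<psi> \<in> Lip0 e"
  using lipschitz_on_add[OF lip_norm_lipschitz[OF assms(1)] lip_norm_lipschitz[OF assms(2)]] assms
  by (auto simp: Lip0_def plus_fun_def)

lemma Lip0_zero: "0 \<in> Lip0 e"
  by (auto simp: Lip0_def lipschitz_on_def intro!: exI[of _ 0])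

lemma lip_norm_zero: "lip_norm (0 :: 'a::metric_space \<Rightarrow> 'b::real_normed_field) = 0"
proof (rule antisym)
  show "lip_norm (0 :: 'a \<Rightarrow> 'b) \<le> 0"
    by (rule lip_norm_le) (auto simp: lipschitz_on_def)
qed (rule lip_norm_nonneg[OF Lip0_zero[of undefined]])

lemma lip_dual_subspace:
  "fvec.subspace (lip_dual e :: (('a::metric_space \<Rightarrow> 'b::real_normed_field) \<Rightarrow> 'b) set)"
proof (rule fvec.subspaceI)
  show "0 \<in> lip_dual e"
    by (auto simp: lip_dual_def intro!: exI[of _ 0])
next
  fix F G :: "('a \<Rightarrow> 'b) \<Rightarrow> 'b" assume FG: "F \<in> lip_dual e" "G \<in> lip_dual e"
  then obtain C D where "\<forall>\<phi>\<in>Lip0 e. norm (F \<phi>) \<le> C * lip_norm \<phi>"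
    "\<forall>\<phi>\<in>Lip0 e. norm (G \<phi>) \<le> D * lip_norm \<phi>"
    by (auto simp: lip_dual_def)
  then have "\<forall>\<phi>\<in>Lip0 e. norm ((F + G) \<phi>) \<le> (C + D) * lip_norm \<phi>"
    by (auto simp: distrib_right intro!: norm_triangle_mono)
  then have "\<exists>C. \<forall>\<phi>\<in>Lip0 e. norm ((F + G) \<phi>) \<le> C * lip_norm \<phi>" by blast
  with FG show "F + G \<in> lip_dual e"
    unfolding lip_dual_def by (simp add: algebra_simps)
next
  fix c and F :: "('a \<Rightarrow> 'b) \<Rightarrow> 'b" assume F: "F \<in> lip_dual e"
  then obtain C where "\<forall>\<phi>\<in>Lip0 e. norm (F \<phi>) \<le> C * lip_norm \<phi>"
    by (auto simp: lip_dual_def)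
  then have "\<forall>\<phi>\<in>Lip0 e. norm (fscale c F \<phi>) \<le> (norm c * C) * lip_norm \<phi>"
    by (auto simp: norm_mult mult.assoc intro!: mult_left_mono)
  then have "\<exists>C. \<forall>\<phi>\<in>Lip0 e. norm (fscale c F \<phi>) \<le> C * lip_norm \<phi>" by blast
  with F show "fscale c F \<in> lip_dual e"
    unfolding lip_dual_def by (simp add: algebra_simps)
qed

lemma dual_norm_bdd:
  assumes "F \<in> lip_dual e"
  shows "bdd_above ((\<lambda>\<phi>. norm (F \<phi>)) ` {\<phi>\<in>Lip0 e. lip_norm \<phi> \<le> 1})"
proof -
  obtain C where C: "\<forall>\<phi>\<in>Lip0 e. norm (F \<phi>) \<le> C * lip_norm \<phi>"
    using assms by (auto simp: lip_dual_def)
  have "norm (F \<phi>) \<le> \<bar>C\<bar>" if "\<phi> \<in> Lip0 e" "lip_norm \<phi> \<le> 1" for \<phi>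
  proof -
    have "norm (F \<phi>) \<le> C * lip_norm \<phi>" using C that by blast
    also have "\<dots> \<le> \<bar>C\<bar> * 1"
      using that lip_norm_nonneg[OF that(1)] by (intro mult_mono) auto
    finally show ?thesis by simp
  qed
  then show ?thesis by (auto intro!: bdd_aboveI[of _ "\<bar>C\<bar>"])
qed

lemma dual_norm_upper:
  assumes "F \<in> lip_dual e" "\<phi> \<in> Lip0 e" "lip_norm \<phi> \<le> 1"
  shows "norm (F \<phi>) \<le> dual_norm e F"
  unfolding dual_norm_def using assms cSUP_upper[OF _ dual_norm_bdd[OF assms(1)], of \<phi>] by simp

lemma dual_norm_nonneg: "0 \<le> dual_norm e F"
proof (cases "F \<in> lip_dual e")
  case True
  have "norm (F 0) \<le> dual_norm e F"
    by (rule dual_norm_upper[OF True]) (auto simp: Lip0_zero lip_norm_zero)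
  then show ?thesis using norm_ge_zero order_trans by blast
qed (simp add: dual_norm_def)

lemma dual_norm_bound:
  assumes F: "F \<in> lip_dual e" and \<phi>: "\<phi> \<in> Lip0 e"
  shows "norm (F \<phi>) \<le> dual_norm e F * lip_norm \<phi>"
proof (cases "lip_norm \<phi> = 0")
  case True
  then show ?thesis using F \<phi> unfolding lip_dual_def by force
next
  case False
  define L where "L = lip_norm \<phi>"
  have L: "L > 0" using False lip_norm_nonneg[OF \<phi>] by (simp add: L_def)
  let ?\<psi> = "fscale (of_real (inverse L)) \<phi>"
  have "lip_norm ?\<psi> \<le> norm (of_real (inverse L) :: 'b) * lip_norm \<phi>"
    by (rule Lip0_fscale(2)[OF \<phi>])
  also have "\<dots> = 1" using L by (simp add: norm_inverse flip: L_def)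
  finally have "norm (F ?\<psi>) \<le> dual_norm e F"
    by (rule dual_norm_upper[OF F Lip0_fscale(1)[OF \<phi>]])
  moreover have "F ?\<psi> = of_real (inverse L) * F \<phi>"
    using F \<phi> by (auto simp: lip_dual_def)
  ultimately have "inverse L * norm (F \<phi>) \<le> dual_norm e F"
    using L by (simp only: norm_mult norm_of_real) simp
  then show ?thesis using L by (simp add: divide_simps mult.commute flip: L_def)
qed

lemma dual_norm_le:
  fixes F :: "('a::metric_space \<Rightarrow> 'b::real_normed_field) \<Rightarrow> 'b"
  assumes "0 \<le> C" "\<And>\<phi>. \<phi> \<in> Lip0 e \<Longrightarrow> norm (F \<phi>) \<le> C * lip_norm \<phi>"
  shows "dual_norm e F \<le> C"
proof (cases "F \<in> lip_dual e")
  case True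
  have "(SUP \<phi>\<in>{\<phi>\<in>Lip0 e. lip_norm \<phi> \<le> 1}. norm (F \<phi>)) \<le> C"
  proof (rule cSUP_least)
    show "{\<phi> \<in> Lip0 e :: ('a \<Rightarrow> 'b) set. lip_norm \<phi> \<le> 1} \<noteq> {}"
      using Lip0_zero[of e] lip_norm_zero[where 'a='a and 'b='b] by force
    fix \<phi> :: "'a \<Rightarrow> 'b" assume "\<phi> \<in> {\<phi> \<in> Lip0 e. lip_norm \<phi> \<le> 1}"
    then show "norm (F \<phi>) \<le> C"
      using assms(2)[of \<phi>] mult_left_le[OF _ assms(1), of "lip_norm \<phi>"] by fastforce
  qed
  with True show ?thesis by (simp add: dual_norm_def)
qed (use assms(1) in \<open>simp add: dual_norm_def\<close>)

lemma dual_norm_minus_commute: "dual_norm e (F - G) = dual_norm e (G - F)"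
proof -
  have "F - G \<in> lip_dual e \<longleftrightarrow> G - F \<in> lip_dual e"
    using fvec.subspace_neg[OF lip_dual_subspace, of "F - G" e]
      fvec.subspace_neg[OF lip_dual_subspace, of "G - F" e] by auto
  then show ?thesis by (simp add: dual_norm_def norm_minus_commute)
qed

lemmas lip_dual_add = fvec.subspace_add[OF lip_dual_subspace]
lemmas lip_dual_scale = fvec.subspace_scale[OF lip_dual_subspace]
lemmas lip_dual_diff = fvec.subspace_diff[OF lip_dual_subspace]

lemma dual_norm_triangle:
  assumes "F \<in> lip_dual e" "G \<in> lip_dual e"
  shows "dual_norm e (F + G) \<le> dual_norm e F + dual_norm e G"
proof (rule dual_norm_le)
  show "0 \<le> dual_norm e F + dual_norm e G"
    by (intro add_nonneg_nonneg dual_norm_nonneg)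
  fix \<phi> :: "'a \<Rightarrow> 'b" assume "\<phi> \<in> Lip0 e"
  then have "norm (F \<phi>) + norm (G \<phi>) \<le> (dual_norm e F + dual_norm e G) * lip_norm \<phi>"
    using assms unfolding distrib_right by (intro add_mono dual_norm_bound)
  then show "norm ((F + G) \<phi>) \<le> (dual_norm e F + dual_norm e G) * lip_norm \<phi>"
    using norm_triangle_ineq[of "F \<phi>" "G \<phi>"] by simp
qed

lemma dual_norm_scale:
  assumes "F \<in> lip_dual e"
  shows "dual_norm e (fscale c F) \<le> norm c * dual_norm e F"
proof (rule dual_norm_le)
  show "0 \<le> norm c * dual_norm e F"
    by (intro mult_nonneg_nonneg dual_norm_nonneg norm_ge_zero)
  fix \<phi> :: "'a \<Rightarrow> 'b" assume "\<phi> \<in> Lip0 e"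
  then show "norm (fscale c F \<phi>) \<le> norm c * dual_norm e F * lip_norm \<phi>"
    using dual_norm_bound[OF assms] by (simp add: norm_mult mult.assoc mult_left_mono)
qed

lemma dual_norm_eq_0:
  assumes "F \<in> lip_dual e" "dual_norm e F = 0"
  shows "F = 0"
proof
  fix \<phi>
  show "F \<phi> = 0 \<phi>"
  proof (cases "\<phi> \<in> Lip0 e")
    case True
    with dual_norm_bound[OF assms(1) True] assms(2) show ?thesis by simp
  qed (use assms(1) in \<open>simp add: lip_dual_def\<close>)
qed

lemma dual_norm_0: "dual_norm e 0 = 0"
  by (intro antisym dual_norm_le dual_norm_nonneg) simp_all

lemma Metric_space_dual: "Metric_space (lip_dual e) (\<lambda>F G. dual_norm e (F - G))"
proof (unfold_locales, goal_cases)
  case (3 F G)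
  then show ?case
    using dual_norm_eq_0[OF lip_dual_diff[OF 3]] by (auto simp: dual_norm_0)
next
  case (4 F G H)
  then show ?case
    using dual_norm_triangle[of "F - G" e "G - H"] by (simp add: lip_dual_diff)
qed (rule dual_norm_nonneg dual_norm_minus_commute)+

lemma dual_closure:
  "dual_topology e closure_of S =
    {F \<in> lip_dual e. \<forall>r>0. \<exists>G\<in>S. G \<in> lip_dual e \<and> dual_norm e (F - G) < r}"
  unfolding dual_topology_def Metric_space.metric_closure_of[OF Metric_space_dual]
  by (auto simp: Metric_space.in_mball[OF Metric_space_dual])

lemma delta_lip_dual: "delta e x \<in> lip_dual e"
proof -
  have "norm (delta e x \<phi>) \<le> dist x e * lip_norm \<phi>" if "\<phi> \<in> Lip0 e" for \<phi> :: "'a \<Rightarrow> 'b"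
    using lipschitz_onD[OF lip_norm_lipschitz[OF that], of x e] that
    by (simp add: delta_def Lip0_def dist_norm mult.commute)
  then show ?thesis
    by (auto simp: lip_dual_def delta_def Lip0_add Lip0_fscale)
qed

lemma span_lip_dual: "fvec.span (range (delta e)) \<subseteq> lip_dual e"
  by (rule fvec.span_minimal) (auto simp: delta_lip_dual lip_dual_subspace)

lemma free_space_eq:
  "free_space e =
    {F \<in> lip_dual e. \<forall>r>0. \<exists>G\<in>fvec.span (range (delta e)). dual_norm e (F - G) < r}"
  unfolding free_space_def dual_closure using span_lip_dual by blast

lemma free_space_lip_dual: "free_space e \<subseteq> lip_dual e"
  by (auto simp: free_space_eq)

lemma span_free_space: "fvec.span (range (delta e)) \<subseteq> free_space e"
  unfolding free_space_eq using span_lip_dual by (auto intro!: bexI simp: dual_norm_0)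

lemma free_space_subspace:
  "fvec.subspace (free_space e :: (('a::metric_space \<Rightarrow> 'b::real_normed_field) \<Rightarrow> 'b) set)"
proof (rule fvec.subspaceI)
  let ?S = "fvec.span (range (delta e)) :: (('a \<Rightarrow> 'b) \<Rightarrow> 'b) set"
  show "0 \<in> free_space e"
    using span_free_space fvec.span_zero by blast
  fix F G :: "('a \<Rightarrow> 'b) \<Rightarrow> 'b" and c
  assume F: "F \<in> free_space e"
  then have F': "F \<in> lip_dual e" using free_space_lip_dual by blast
  show "fscale c F \<in> free_space e"
    unfolding free_space_eq
  proof safe
    show "fscale c F \<in> lip_dual e" by (rule lip_dual_scale[OF F'])
    fix r :: real assume r: "0 < r"
    then have "r / (norm c + 1) > 0" by (simp add: add_nonneg_pos)
    then obtain A where A: "A \<in> ?S" "dual_norm e (F - A) < r / (norm c + 1)"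
      using F by (auto simp: free_space_eq)
    have A': "A \<in> lip_dual e" using A(1) span_lip_dual by blast
    have "dual_norm e (fscale c F - fscale c A) \<le> norm c * dual_norm e (F - A)"
      using dual_norm_scale[OF lip_dual_diff[OF F' A'], of c]
      by (simp add: fvec.scale_right_diff_distrib)
    also have "\<dots> \<le> (norm c + 1) * dual_norm e (F - A)"
      by (intro mult_right_mono dual_norm_nonneg) simp
    also have "\<dots> < r"
      using A(2) by (simp add: pos_less_divide_eq add_nonneg_pos mult.commute)
    finally show "\<exists>B\<in>?S. dual_norm e (fscale c F - B) < r"
      using fvec.span_scale[OF A(1)] by blast
  qed
  assume G: "G \<in> free_space e"
  then have G': "G \<in> lip_dual e" using free_space_lip_dual by blast
  show "F + G \<in> free_space e"
    unfolding free_space_eq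
  proof safe
    show "F + G \<in> lip_dual e" by (rule lip_dual_add[OF F' G'])
    fix r :: real assume "0 < r"
    then have r: "r / 2 > 0" by simp
    obtain A where A: "A \<in> ?S" "dual_norm e (F - A) < r / 2"
      using F r unfolding free_space_eq by blast
    obtain B where B: "B \<in> ?S" "dual_norm e (G - B) < r / 2"
      using G r unfolding free_space_eq by blast
    have "A \<in> lip_dual e" "B \<in> lip_dual e" using A(1) B(1) span_lip_dual by blast+
    then have "dual_norm e ((F - A) + (G - B)) \<le> dual_norm e (F - A) + dual_norm e (G - B)"
      by (intro dual_norm_triangle lip_dual_diff F' G')
    then have "dual_norm e ((F + G) - (A + B)) < r"
      using A(2) B(2) by (simp add: algebra_simps)
    then show "\<exists>C\<in>?S. dual_norm e (F + G - C) < r"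
      using fvec.span_add[OF A(1) B(1)] by blast
  qed
qed

lemma Lip0_comp:
  assumes f: "C-lipschitz_on UNIV f" and \<phi>: "\<phi> \<in> Lip0 e"
  shows "(\<lambda>x. \<phi> (f x) - \<phi> (f e)) \<in> Lip0 e"
    and "lip_norm (\<lambda>x. \<phi> (f x) - \<phi> (f e)) \<le> C * lip_norm \<phi>"
proof -
  have "(lip_norm \<phi> * C)-lipschitz_on UNIV (\<phi> \<circ> f)"
    by (rule lipschitz_on_compose[OF f])
      (use lip_norm_lipschitz[OF \<phi>] in \<open>auto intro: lipschitz_on_subset\<close>)
  then have "(C * lip_norm \<phi>)-lipschitz_on UNIV (\<lambda>x. \<phi> (f x) - \<phi> (f e))"
    by (simp add: lipschitz_on_def dist_norm mult.commute)
  then show "(\<lambda>x. \<phi> (f x) - \<phi> (f e)) \<in> Lip0 e"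
    "lip_norm (\<lambda>x. \<phi> (f x) - \<phi> (f e)) \<le> C * lip_norm \<phi>"
    by (auto simp: Lip0_def intro: lip_norm_le)
qed

lemma bounded_operator_unique:
  fixes T U :: "(('a::metric_space \<Rightarrow> 'b::real_normed_field) \<Rightarrow> 'b) \<Rightarrow> (('a \<Rightarrow> 'b) \<Rightarrow> 'b)"
  assumes T: "bounded_operator e T" and U: "bounded_operator e U"
    and eq: "\<And>x. T (delta e x) = U (delta e x)"
  shows "T = U"
proof
  fix F :: "('a \<Rightarrow> 'b) \<Rightarrow> 'b"
  let ?S = "fvec.span (range (delta e)) :: (('a \<Rightarrow> 'b) \<Rightarrow> 'b) set"
  note sub = subsetD[OF span_free_space] subsetD[OF free_space_lip_dual]
  have add: "T (A + B) = T A + T B" "U (A + B) = U A + U B"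
    if "A \<in> free_space e" "B \<in> free_space e" for A B
    using T U that by (auto simp: bounded_operator_def)
  have scale: "T (fscale c A) = fscale c (T A)" "U (fscale c A) = fscale c (U A)"
    if "A \<in> free_space e" for A c
    using T U that by (auto simp: bounded_operator_def)
  have mem: "T A \<in> lip_dual e" "U A \<in> lip_dual e" if "A \<in> free_space e" for A
    using T U that unfolding bounded_operator_def by (blast intro: sub(2))+
  have zero: "T 0 = 0" "U 0 = 0"
    using scale[of 0 0] fvec.subspace_0[OF free_space_subspace, of e] by simp_all
  have diff: "T (A - B) = T A - T B" "U (A - B) = U A - U B"
    if "A \<in> free_space e" "B \<in> free_space e" for A B
    using add[OF fvec.subspace_diff[OF free_space_subspace that] that(2)] by simp_all
  obtain C where C: "\<And>A. A \<in> free_space e \<Longrightarrow> dual_norm e (T A) \<le> C * dual_norm e A"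
    using T unfolding bounded_operator_def by blast
  obtain D where D: "\<And>A. A \<in> free_space e \<Longrightarrow> dual_norm e (U A) \<le> D * dual_norm e A"
    using U unfolding bounded_operator_def by blast
  have span: "T A = U A" if "A \<in> ?S" for A
  proof -
    have "A \<in> free_space e \<and> T A = U A"
    proof (rule fvec.span_induct_alt[OF that])
      show "0 \<in> free_space e \<and> T 0 = U 0"
        using fvec.subspace_0[OF free_space_subspace] zero by metis
      fix c and x y :: "('a \<Rightarrow> 'b) \<Rightarrow> 'b"
      assume x: "x \<in> range (delta e)" and y: "y \<in> free_space e \<and> T y = U y"
      have x': "x \<in> free_space e" using sub(1) fvec.span_base[OF x] .
      have "T x = U x" using x eq by blast
      moreover have cx: "fscale c x \<in> free_space e"
        by (rule fvec.subspace_scale[OF free_space_subspace x'])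
      ultimately show "fscale c x + y \<in> free_space e \<and> T (fscale c x + y) = U (fscale c x + y)"
        using y fvec.subspace_add[OF free_space_subspace cx] add[OF cx] scale[OF x'] by metis
    qed
    then show ?thesis ..
  qed
  show "T F = U F"
  proof (cases "F \<in> free_space e")
    case F: True
    let ?K = "\<bar>C\<bar> + \<bar>D\<bar> + 1"
    have "dual_norm e (T F - U F) \<le> 0"
    proof (rule field_le_epsilon)
      fix r :: real assume r: "0 < r"
      then have "r / ?K > 0" by simp
      then obtain A where A: "A \<in> ?S" "dual_norm e (F - A) < r / ?K"
        using F unfolding free_space_eq by blast
      have A': "A \<in> free_space e" and FA: "F - A \<in> free_space e"
        using A(1) sub(1) fvec.subspace_diff[OF free_space_subspace F] by blast+
      have "T F - U F = T (F - A) - U (F - A)"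
        by (simp add: diff[OF F A'] span[OF A(1)])
      also have "\<dots> = T (F - A) + fscale (-1) (U (F - A))"
        by (simp add: fun_eq_iff)
      finally have "dual_norm e (T F - U F) \<le>
          dual_norm e (T (F - A)) + dual_norm e (fscale (-1) (U (F - A)))"
        using dual_norm_triangle[OF mem(1)[OF FA] lip_dual_scale[OF mem(2)[OF FA]], of "-1"]
        by simp
      also have "\<dots> \<le> dual_norm e (T (F - A)) + dual_norm e (U (F - A))"
        using dual_norm_scale[OF mem(2)[OF FA], of "-1"] by simp
      also have "\<dots> \<le> C * dual_norm e (F - A) + D * dual_norm e (F - A)"
        by (intro add_mono C D FA)
      also have "\<dots> = (C + D) * dual_norm e (F - A)"
        by (simp add: algebra_simps)
      also have "\<dots> \<le> ?K * dual_norm e (F - A)"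
        by (intro mult_right_mono dual_norm_nonneg) simp
      also have "\<dots> \<le> r"
        using A(2) by (simp add: pos_less_divide_eq mult.commute)
      finally show "dual_norm e (T F - U F) \<le> 0 + r" by simp
    qed
    then have "T F - U F = 0"
      using dual_norm_eq_0[OF lip_dual_diff[OF mem(1)[OF F] mem(2)[OF F]]]
        dual_norm_nonneg[of e "T F - U F"] by simp
    then show ?thesis by simp
  next
    case False
    then show ?thesis using T U by (simp add: bounded_operator_def)
  qed
qed

lemma free_operator_ex1:
  fixes f :: "'a::metric_space \<Rightarrow> 'a"
  assumes "\<exists>C. C-lipschitz_on UNIV f"
  shows "\<exists>!T :: (('a \<Rightarrow> 'b::real_normed_field) \<Rightarrow> 'b) \<Rightarrow> (('a \<Rightarrow> 'b) \<Rightarrow> 'b).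
    bounded_operator e T \<and> (\<forall>x. T (delta e x) = delta e (f x) - delta e (f e))"
proof -
  obtain C where C: "C-lipschitz_on UNIV f" using assms by blast
  then have C0: "0 \<le> C" by (rule lipschitz_on_nonneg)
  define g where "g = (\<lambda>(\<phi> :: 'a \<Rightarrow> 'b) x. \<phi> (f x) - \<phi> (f e))"
  have g: "g \<phi> \<in> Lip0 e" "lip_norm (g \<phi>) \<le> C * lip_norm \<phi>" if "\<phi> \<in> Lip0 e" for \<phi>
    using Lip0_comp[OF C that] by (simp_all add: g_def)
  have g_add: "g (\<phi> + \<psi>) = g \<phi> + g \<psi>" and g_scale: "g (fscale c \<phi>) = fscale c (g \<phi>)"
    for \<phi> \<psi> c by (auto simp: g_def fun_eq_iff algebra_simps)
  define R where "R = (\<lambda>(F :: ('a \<Rightarrow> 'b) \<Rightarrow> 'b) \<phi>. if \<phi> \<in> Lip0 e then F (g \<phi>) else 0)"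
  have R_bound: "norm (R F \<phi>) \<le> (C * dual_norm e F) * lip_norm \<phi>"
    if "F \<in> lip_dual e" "\<phi> \<in> Lip0 e" for F \<phi>
  proof -
    have "norm (F (g \<phi>)) \<le> dual_norm e F * lip_norm (g \<phi>)"
      by (rule dual_norm_bound[OF that(1) g(1)[OF that(2)]])
    also have "\<dots> \<le> dual_norm e F * (C * lip_norm \<phi>)"
      by (intro mult_left_mono g(2) that dual_norm_nonneg)
    finally show ?thesis using that by (simp add: R_def mult_ac)
  qed
  have R_dual: "R F \<in> lip_dual e" if F: "F \<in> lip_dual e" for F
    unfolding lip_dual_def
  proof (intro CollectI conjI ballI allI impI)
    fix \<phi> \<psi> :: "'a \<Rightarrow> 'b" assume "\<phi> \<in> Lip0 e" "\<psi> \<in> Lip0 e"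
    then show "R F (\<phi> + \<psi>) = R F \<phi> + R F \<psi>"
      using F by (simp add: R_def g_add Lip0_add g(1) lip_dual_def)
  next
    fix c and \<phi> :: "'a \<Rightarrow> 'b" assume "\<phi> \<in> Lip0 e"
    then show "R F (fscale c \<phi>) = c * R F \<phi>"
      using F by (simp add: R_def g_scale Lip0_fscale g(1) lip_dual_def)
  next
    show "\<exists>C. \<forall>\<phi>\<in>Lip0 e. norm (R F \<phi>) \<le> C * lip_norm \<phi>"
      using R_bound[OF F] by blast
  qed (simp add: R_def)
  have R_norm: "dual_norm e (R F) \<le> C * dual_norm e F" if "F \<in> lip_dual e" for F
    by (rule dual_norm_le) (use R_bound[OF that] C0 in \<open>simp_all add: dual_norm_nonneg\<close>)
  have R_add: "R (F + G) = R F + R G" and R_diff: "R (F - G) = R F - R G"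
    and R_scale: "R (fscale c F) = fscale c (R F)" and R_0: "R 0 = 0" for F G c
    by (auto simp: R_def fun_eq_iff)
  have R_delta: "R (delta e x) = delta e (f x) - delta e (f e)" for x
    by (rule ext) (simp add: R_def delta_def g(1), simp add: g_def)
  have R_span: "R F \<in> fvec.span (range (delta e))" if "F \<in> fvec.span (range (delta e))" for F
  proof (rule fvec.span_induct_alt[OF that])
    show "R 0 \<in> fvec.span (range (delta e))"
      unfolding R_0 by (rule fvec.span_zero)
    fix c and x y :: "('a \<Rightarrow> 'b) \<Rightarrow> 'b"
    assume "x \<in> range (delta e)" and y: "R y \<in> fvec.span (range (delta e))"
    then obtain z where z: "x = delta e z" by blast
    have x: "R x \<in> fvec.span (range (delta e))"
      unfolding z R_delta by (intro fvec.span_diff fvec.span_base rangeI)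
    show "R (fscale c x + y) \<in> fvec.span (range (delta e))"
      unfolding R_add R_scale by (rule fvec.span_add[OF fvec.span_scale[OF x] y])
  qed
  have R_free: "R F \<in> free_space e" if F: "F \<in> free_space e" for F
    unfolding free_space_eq
  proof safe
    have F': "F \<in> lip_dual e" using F free_space_lip_dual by blast
    then show "R F \<in> lip_dual e" by (rule R_dual)
    fix r :: real assume r: "0 < r"
    then have "r / (C + 1) > 0" using C0 by simp
    then obtain A where A: "A \<in> fvec.span (range (delta e))" "dual_norm e (F - A) < r / (C + 1)"
      using F unfolding free_space_eq by blast
    have "A \<in> lip_dual e" using A(1) span_lip_dual by blast
    then have "dual_norm e (R F - R A) \<le> C * dual_norm e (F - A)"
      using R_norm[OF lip_dual_diff[OF F']] by (simp add: R_diff)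
    also have "\<dots> \<le> (C + 1) * dual_norm e (F - A)"
      by (intro mult_right_mono dual_norm_nonneg) simp
    also have "\<dots> < r"
      using A(2) C0 by (simp add: pos_less_divide_eq mult.commute)
    finally show "\<exists>B\<in>fvec.span (range (delta e)). dual_norm e (R F - B) < r"
      using R_span[OF A(1)] by blast
  qed
  define T where "T = (\<lambda>F. if F \<in> free_space e then R F else 0)"
  have "bounded_operator e T"
    unfolding bounded_operator_def
  proof (intro conjI)
    show "\<exists>C. \<forall>F\<in>free_space e. dual_norm e (T F) \<le> C * dual_norm e F"
      using R_norm free_space_lip_dual by (auto simp: T_def intro!: exI[of _ C])
  qed (auto simp: T_def R_free R_add R_scale fvec.subspace_add[OF free_space_subspace]
      fvec.subspace_scale[OF free_space_subspace])
  moreover have "T (delta e x) = delta e (f x) - delta e (f e)" for x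
  proof -
    have "(delta e x :: ('a \<Rightarrow> 'b) \<Rightarrow> 'b) \<in> free_space e"
      using span_free_space fvec.span_base by blast
    then show ?thesis by (simp add: T_def R_delta)
  qed
  ultimately show ?thesis
    by (intro ex1I[of _ T]) (auto intro!: bounded_operator_unique)
qed

end

theory Submission
  imports Defs
begin

text \<open>
  A closed \<open>f\<close>-invariant set \<open>A\<close> with at least two points and \<open>A \<noteq> M\<close> gives an invariant subspace:
  the functionals that annihilate all Lipschitz functions constant on \<open>A\<close>. If there is no such
  \<open>A\<close>, then every point that is not fixed has a dense orbit, and there is at most one fixed point.
  The return times to a compact set \<open>K\<close> with non-empty interior and without fixed points are then
  bounded on \<open>K\<close> by compactness, so finitely many iterates of \<open>K\<close> cover the space, which is
  therefore compact.
\<close>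

subsection \<open>Closed invariant sets\<close>

lemma continuous_on_funpow:
  fixes f :: "'a::topological_space \<Rightarrow> 'a"
  assumes "continuous_on UNIV f"
  shows "continuous_on UNIV (f ^^ n)"
proof (induction n)
  case (Suc n)
  then show ?case
    using continuous_on_compose[of UNIV "f ^^ n" f] assms continuous_on_subset by auto
qed (simp add: id_def)

lemma closure_orbit_invariant:
  fixes f :: "'a::topological_space \<Rightarrow> 'a"
  assumes "continuous_on UNIV f"
  shows "f ` closure (range (\<lambda>n. (f ^^ n) y)) \<subseteq> closure (range (\<lambda>n. (f ^^ n) y))"
proof (rule image_closure_subset)
  show "continuous_on (closure (range (\<lambda>n. (f ^^ n) y))) f"
    using assms continuous_on_subset by blast
  have "f ((f ^^ n) y) \<in> range (\<lambda>n. (f ^^ n) y)" for n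
    by (rule range_eqI[of _ _ "Suc n"]) simp
  then show "f ` range (\<lambda>n. (f ^^ n) y) \<subseteq> closure (range (\<lambda>n. (f ^^ n) y))"
    using closure_subset by blast
qed simp

text \<open>Once the orbit reaches a fixed point it is constant, so its values at times
  \<open>0\<close> to \<open>m\<close> exhaust it. In an infinite space such an orbit cannot be
  dense.\<close>

lemma finite_orbit:
  assumes "f ((f ^^ m) y) = (f ^^ m) y"
  shows "finite (range (\<lambda>n. (f ^^ n) y))"
proof (rule finite_subset)
  have "(f ^^ (m + k)) y = (f ^^ m) y" for k
    by (induction k) (simp_all add: assms)
  then have "(f ^^ n) y = (f ^^ min n m) y" for n
    using le_add_diff_inverse[of m n] by (metis min_def nat_le_linear)
  then have "(f ^^ n) y \<in> (\<lambda>n. (f ^^ n) y) ` {..m}" for n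
    by (rule image_eqI) simp
  then show "range (\<lambda>n. (f ^^ n) y) \<subseteq> (\<lambda>n. (f ^^ n) y) ` {..m}" by blast
qed simp

text \<open>Returns are required to enter the open set \<open>U\<close>, so that the points of
  \<open>K\<close> with a given return time lie in an open set. Compactness then bounds the return
  times uniformly, and the union of boundedly many iterates of \<open>K\<close> is
  invariant.\<close>

lemma compact_invariant_of_return:
  fixes f :: "'a::topological_space \<Rightarrow> 'a"
  assumes cont: "continuous_on UNIV f" and K: "compact K" and U: "open U" "U \<subseteq> K"
    and ret: "\<And>y. y \<in> K \<Longrightarrow> \<exists>n. (f ^^ Suc n) y \<in> U"
  obtains L where "compact L" "K \<subseteq> L" "f ` L \<subseteq> L"
proof -
  have "open ((f ^^ Suc n) -` U)" for n
    using open_vimage[OF U(1) continuous_on_funpow[OF cont]] .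
  then obtain I where I: "finite I" "K \<subseteq> (\<Union>n\<in>I. (f ^^ Suc n) -` U)"
  proof (rule compactE_image[OF K, of UNIV "\<lambda>n. (f ^^ Suc n) -` U"])
    show "K \<subseteq> (\<Union>n. (f ^^ Suc n) -` U)" using ret by blast
  qed blast+
  \<comment> \<open>The return times \<open>Suc n\<close> now lie between \<open>1\<close> and
    \<open>N\<close>. The successor keeps \<open>N\<close> positive even when \<open>I\<close> is
    empty, so that \<open>j = 0\<close> always indexes a part of \<open>L\<close>.\<close>
  define N where "N = Suc (Max I)"
  have N: "\<exists>n<N. (f ^^ Suc n) y \<in> K" if y: "y \<in> K" for y
  proof -
    obtain n where n: "n \<in> I" "(f ^^ Suc n) y \<in> U" using I(2) y by blast
    then have "n < N" using I(1) by (simp add: N_def less_Suc_eq_le)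
    then show ?thesis using n(2) U(2) by blast
  qed
  define L where "L = (\<Union>j<N. (f ^^ j) ` K)"
  show ?thesis
  proof
    show "compact L"
      unfolding L_def using K continuous_on_funpow[OF cont]
      by (intro compact_UN compact_continuous_image) (auto intro: continuous_on_subset)
    show "K \<subseteq> L"
      by (auto simp: L_def N_def image_iff intro!: bexI[of _ 0])
    have "f ((f ^^ j) y) \<in> L" if y: "y \<in> K" and j: "j < N" for j y
    proof (cases "Suc j < N")
      case True
      then show ?thesis
        using y by (auto simp: L_def intro!: bexI[of _ "Suc j"])
    next
      case False
      \<comment> \<open>Here \<open>Suc j = N\<close>. The orbit has been back in \<open>K\<close>
        at time \<open>Suc n\<close>, and the remaining \<open>N - Suc n\<close> steps are fewer
        than \<open>N\<close>.\<close>
      obtain n where n: "n < N" "(f ^^ Suc n) y \<in> K" using N y by blast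
      have "Suc j = (N - Suc n) + Suc n" using False n(1) j by simp
      then have "f ((f ^^ j) y) = (f ^^ (N - Suc n)) ((f ^^ Suc n) y)"
        by (metis comp_apply funpow.simps(2) funpow_add)
      then show ?thesis
        using n by (auto simp: L_def simp del: funpow.simps)
    qed
    then show "f ` L \<subseteq> L" by (auto simp: L_def)
  qed
qed

lemma ex_closed_invariant_set:
  fixes f :: "'a::metric_space \<Rightarrow> 'a" and x :: 'a
  assumes noncompact: "\<not> compact (UNIV :: 'a set)" and cont: "continuous_on UNIV f"
    and r: "r > 0" "compact (cball x r)"
  obtains A a b where "closed A" "A \<noteq> UNIV" "f ` A \<subseteq> A" "a \<in> A" "b \<in> A" "a \<noteq> b"
proof (rule ccontr)
  assume "\<not> thesis"
  \<comment> \<open>The negated conclusion, in the form applied below to orbit closures, to a pair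
    of fixed points and to the compact set \<open>L\<close>.\<close>
  then have everything: "A = UNIV"
    if "closed A" "f ` A \<subseteq> A" "a \<in> A" "b \<in> A" "a \<noteq> b" for A a b
    using that \<open>\<And>A b a. \<lbrakk>closed A; A \<noteq> UNIV; f ` A \<subseteq> A; a \<in> A; b \<in> A; a \<noteq> b\<rbrakk> \<Longrightarrow> thesis\<close> by blast
  have inf: "infinite (UNIV :: 'a set)"
    using noncompact finite_imp_compact by blast
  have dense: "closure (range (\<lambda>n. (f ^^ n) y)) = UNIV" if "f y \<noteq> y" for y
  proof (rule everything)
    have "(f ^^ n) y \<in> closure (range (\<lambda>n. (f ^^ n) y))" for n
      by (rule subsetD[OF closure_subset rangeI])
    from this[of 1] this[of 0]
    show "f y \<in> closure (range (\<lambda>n. (f ^^ n) y))" "y \<in> closure (range (\<lambda>n. (f ^^ n) y))"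
      by simp_all
  qed (use that closure_orbit_invariant[OF cont] in auto)
  have never_fixed: "f ((f ^^ m) y) \<noteq> (f ^^ m) y" if "f y \<noteq> y" for y m
  proof
    assume "f ((f ^^ m) y) = (f ^^ m) y"
    then have fin: "finite (range (\<lambda>n. (f ^^ n) y))" by (rule finite_orbit)
    then show False
      using dense[OF that] inf by (simp add: closure_closed finite_imp_closed)
  qed
  have hit: "\<exists>n. (f ^^ n) y \<in> U" if "f y \<noteq> y" "open U" "U \<noteq> {}" for y U
    using dense[OF that(1)] that open_Int_closure_eq_empty[OF that(2)] by fastforce
  have "\<exists>y. f y \<noteq> y"
  proof (rule ccontr)
    assume "\<nexists>y. f y \<noteq> y"
    moreover obtain z where "z \<noteq> x"
      using ex_new_if_finite[OF inf, of "{x}"] by auto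
    ultimately have "{x, z} = UNIV"
      by (intro everything[of _ x z]) auto
    moreover have "finite {x, z}" by simp
    ultimately show False using inf by simp
  qed
  then obtain y where y: "f y \<noteq> y" by blast
  \<comment> \<open>The centre \<open>x\<close> may itself be fixed, so a non-fixed point near it is
    taken from the dense orbit of \<open>y\<close>.\<close>
  obtain m where m: "(f ^^ m) y \<in> ball x r"
    using hit[OF y, of "ball x r"] r(1) by auto
  define z where "z = (f ^^ m) y"
  have z: "f z \<noteq> z" using never_fixed[OF y] by (simp add: z_def)
  have "open {w. f w \<noteq> w}"
    by (rule open_Collect_neq) (use cont in \<open>auto intro: continuous_intros\<close>)
  then have "open ({w. f w \<noteq> w} \<inter> ball x r)" by blast
  then obtain s where s: "s > 0" "cball z s \<subseteq> {w. f w \<noteq> w} \<inter> ball x r"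
    using z m unfolding open_contains_cball z_def by blast
  have "compact (cball z s)"
    using compact_Int_closed[OF r(2) closed_cball[of z s]] s(2) ball_subset_cball[of x r]
    by (metis inf.absorb2 le_inf_iff order_trans)
  moreover have "\<exists>n. (f ^^ Suc n) w \<in> ball z s" if "w \<in> cball z s" for w
  proof -
    have "f w \<noteq> w" using s that by blast
    \<comment> \<open>Starting from \<open>f w\<close> turns a hit at time \<open>n\<close>,
      possibly \<open>0\<close>, into a return of \<open>w\<close> at the positive time
      \<open>Suc n\<close>.\<close>
    then have "f (f w) \<noteq> f w" using never_fixed[of w 1] by simp
    from hit[OF this, of "ball z s"] show ?thesis
      using s(1) by (auto simp: funpow_Suc_right simp del: funpow.simps)
  qed
  ultimately obtain L where L: "compact L" "cball z s \<subseteq> L" "f ` L \<subseteq> L"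
    using compact_invariant_of_return[OF cont, of "cball z s" "ball z s"] by auto
  have "z \<in> L" using L(2) s(1) by auto
  then have "L = UNIV"
    using everything[of L "f z" z] z L compact_imp_closed by blast
  then show False using L(1) noncompact by simp
qed

subsection \<open>Invariant subspaces from invariant sets\<close>

lemma delta_free_space: "delta e x \<in> free_space e"
  using span_free_space fvec.span_base by blast

section \<open>The operator as precomposition with \<open>f\<close>\<close>

lemma free_operator:
  fixes f :: "'a::metric_space \<Rightarrow> 'a" and e :: 'a
  assumes "\<exists>C. C-lipschitz_on UNIV f"
  defines "T \<equiv> free_operator f e ::
    (('a \<Rightarrow> 'k::real_normed_field) \<Rightarrow> 'k) \<Rightarrow> (('a \<Rightarrow> 'k) \<Rightarrow> 'k)"
  shows "bounded_operator e T" "T (delta e x) = delta e (f x) - delta e (f e)"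
  using theI'[OF free_operator_ex1[OF assms(1), of e, where 'b = 'k]]
  unfolding T_def free_operator_def by blast+

text \<open>The description by \<open>THE\<close> fixes the operator only on the evaluations. Both
  sides are linear and bounded in \<open>F\<close> and agree on the span of the evaluations, which
  is dense in \<open>free_space e\<close>.\<close>

lemma free_operator_apply:
  fixes F :: "('a::metric_space \<Rightarrow> 'k::real_normed_field) \<Rightarrow> 'k"
  assumes f: "\<exists>C. C-lipschitz_on UNIV f" and F: "F \<in> free_space e" and \<phi>: "\<phi> \<in> Lip0 e"
  shows "free_operator f e F \<phi> = F (\<lambda>x. \<phi> (f x) - \<phi> (f e))"
proof -
  define T where "T = (free_operator f e ::
    (('a \<Rightarrow> 'k::real_normed_field) \<Rightarrow> 'k) \<Rightarrow> (('a \<Rightarrow> 'k) \<Rightarrow> 'k))"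
  define \<psi> where "\<psi> = (\<lambda>x. \<phi> (f x) - \<phi> (f e))"
  have \<psi>: "\<psi> \<in> Lip0 e" using f Lip0_comp(1)[OF _ \<phi>] by (auto simp: \<psi>_def)
  have T: "bounded_operator e T" "\<And>x. T (delta e x) = delta e (f x) - delta e (f e)"
    unfolding T_def using free_operator[OF f] by blast+
  have add: "T (A + B) = T A + T B" if "A \<in> free_space e" "B \<in> free_space e" for A B
    using T(1) that unfolding bounded_operator_def by blast
  have scale: "T (fscale c A) = fscale c (T A)" and mem: "T A \<in> lip_dual e"
    if "A \<in> free_space e" for A c
    using T(1) that free_space_lip_dual unfolding bounded_operator_def by blast+
  obtain C where C: "\<And>A. A \<in> free_space e \<Longrightarrow> dual_norm e (T A) \<le> C * dual_norm e A"
    using T(1) unfolding bounded_operator_def by blast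
  have span: "A \<in> free_space e \<and> T A \<phi> = A \<psi>" if "A \<in> fvec.span (range (delta e))" for A
  proof (rule fvec.span_induct_alt[OF that])
    let ?zero = "0 :: ('a \<Rightarrow> 'k) \<Rightarrow> 'k"
    have "?zero \<in> free_space e" by (rule fvec.subspace_0[OF free_space_subspace])
    then show "?zero \<in> free_space e \<and> T ?zero \<phi> = ?zero \<psi>"
      using scale[of 0 0] by simp
    fix c and D G :: "('a \<Rightarrow> 'k) \<Rightarrow> 'k"
    assume "D \<in> range (delta e)" and G: "G \<in> free_space e \<and> T G \<phi> = G \<psi>"
    then obtain z where z: "D = delta e z" by blast
    have D: "D \<in> free_space e" unfolding z by (rule delta_free_space)
    then have cD: "fscale c D \<in> free_space e"
      by (rule fvec.subspace_scale[OF free_space_subspace])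
    have "T D \<phi> = D \<psi>"
      unfolding z T(2) using \<phi> \<psi> by (simp add: delta_def, simp add: \<psi>_def)
    then show "fscale c D + G \<in> free_space e \<and> T (fscale c D + G) \<phi> = (fscale c D + G) \<psi>"
      using G cD fvec.subspace_add[OF free_space_subspace cD]
      by (simp add: add scale[OF D])
  qed
  \<comment> \<open>A bound for the functional sending \<open>G\<close> to
    \<open>T G \<phi> - G \<psi>\<close>. The absolute value is taken because the sign of
    \<open>C\<close> is unknown, and the added \<open>1\<close> permits division by
    \<open>E\<close>.\<close>
  define E where "E = \<bar>C\<bar> * lip_norm \<phi> + lip_norm \<psi> + 1"
  have E: "E > 0"
    using lip_norm_nonneg[OF \<phi>] lip_norm_nonneg[OF \<psi>] by (simp add: E_def add_nonneg_pos)
  have "norm (T F \<phi> - F \<psi>) \<le> 0"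
  proof (rule field_le_epsilon)
    fix \<epsilon> :: real assume "0 < \<epsilon>"
    then have "\<epsilon> / E > 0" using E by simp
    then obtain A where A: "A \<in> fvec.span (range (delta e))" "dual_norm e (F - A) < \<epsilon> / E"
      using F unfolding free_space_eq by blast
    have A': "A \<in> free_space e" and FA: "F - A \<in> free_space e"
      using span[OF A(1)] fvec.subspace_diff[OF free_space_subspace F] by blast+
    have "T F = T (F - A) + T A" using add[OF FA A'] by simp
    then have "T F \<phi> - F \<psi> = T (F - A) \<phi> - (F - A) \<psi>"
      using span[OF A(1)] by simp
    also have "norm \<dots> \<le> norm (T (F - A) \<phi>) + norm ((F - A) \<psi>)"
      by (rule norm_triangle_ineq4)
    also have "\<dots> \<le> dual_norm e (T (F - A)) * lip_norm \<phi> + dual_norm e (F - A) * lip_norm \<psi>"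
      by (intro add_mono dual_norm_bound mem[OF FA] subsetD[OF free_space_lip_dual FA] \<phi> \<psi>)
    also have "\<dots> \<le> (\<bar>C\<bar> * dual_norm e (F - A)) * lip_norm \<phi> + dual_norm e (F - A) * lip_norm \<psi>"
      using C[OF FA] mult_right_mono[OF abs_ge_self[of C] dual_norm_nonneg[of e "F - A"]]
      by (intro add_right_mono mult_right_mono lip_norm_nonneg[OF \<phi>]) linarith
    also have "\<dots> \<le> E * dual_norm e (F - A)"
      using dual_norm_nonneg[of e "F - A"] by (simp add: E_def algebra_simps)
    also have "\<dots> \<le> \<epsilon>"
      using A(2) E by (simp add: pos_less_divide_eq mult.commute)
    finally show "norm (T F \<phi> - F \<psi>) \<le> 0 + \<epsilon>" by simp
  qed
  then show ?thesis by (simp add: T_def \<psi>_def)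
qed

section \<open>Annihilators of the functions constant on a set\<close>

lemma of_real_lipschitz_in_Lip0:
  assumes "C-lipschitz_on UNIV g"
  shows "(\<lambda>y. of_real (g y - g e) :: 'k::real_normed_field) \<in> Lip0 e"
proof -
  have "C-lipschitz_on UNIV (\<lambda>y. of_real (g y - g e) :: 'k)"
    using assms by (simp add: lipschitz_on_def dist_norm flip: of_real_diff)
  then show ?thesis by (auto simp: Lip0_def)
qed

lemma infdist_lipschitz: "1-lipschitz_on UNIV (\<lambda>y. infdist y A)"
  by (rule lipschitz_onI) (use infdist_triangle_abs in \<open>auto simp: dist_real_def\<close>)

text \<open>Over the real or complex field this is, by Hahn-Banach, the closed span of all
  \<open>delta e a - delta e b\<close> with \<open>a\<close> and \<open>b\<close> in
  \<open>A\<close>. Constancy replaces vanishing on \<open>A\<close> because neither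
  \<open>e \<in> A\<close> nor \<open>f e = e\<close> is assumed.\<close>

definition const_annihilator :: "'a::metric_space \<Rightarrow> 'a set \<Rightarrow>
    (('a \<Rightarrow> 'k::real_normed_field) \<Rightarrow> 'k) set"
  where "const_annihilator e A =
    {F \<in> free_space e. \<forall>\<phi>\<in>Lip0 e. \<phi> constant_on A \<longrightarrow> F \<phi> = 0}"

lemma subspace_const_annihilator: "fvec.subspace (const_annihilator e A)"
  using fvec.subspace_0[OF free_space_subspace] fvec.subspace_add[OF free_space_subspace]
    fvec.subspace_scale[OF free_space_subspace]
  by (intro fvec.subspaceI) (auto simp: const_annihilator_def)

text \<open>Evaluation at a fixed \<open>\<phi>\<close> is continuous for the dual norm, and
  \<open>free_space e\<close> is itself a closure.\<close>

lemma closedin_const_annihilator: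
  "closedin (dual_topology e)
    (const_annihilator e A :: (('a::metric_space \<Rightarrow> 'k::real_normed_field) \<Rightarrow> 'k) set)"
    (is "closedin _ ?S")
proof -
  have S: "?S \<subseteq> lip_dual e"
    using free_space_lip_dual by (auto simp: const_annihilator_def)
  have top: "topspace (dual_topology e) = lip_dual e"
    by (simp add: dual_topology_def Metric_space.topspace_mtopology[OF Metric_space_dual])
  have "F \<in> ?S" if "F \<in> dual_topology e closure_of ?S" for F
  proof -
    have F: "F \<in> lip_dual e" using that by (simp add: dual_closure)
    have "dual_topology e closure_of ?S \<subseteq> free_space e"
      unfolding free_space_def
      by (rule closure_of_minimal) (auto simp: const_annihilator_def free_space_def)
    moreover have "F \<phi> = 0" if \<phi>: "\<phi> \<in> Lip0 e" "\<phi> constant_on A" for \<phi>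
    proof -
      have "norm (F \<phi>) \<le> 0"
      proof (rule field_le_epsilon)
        fix \<epsilon> :: real assume "0 < \<epsilon>"
        then have "\<epsilon> / (lip_norm \<phi> + 1) > 0"
          using lip_norm_nonneg[OF \<phi>(1)] by simp
        then obtain G where G: "G \<in> ?S" "dual_norm e (F - G) < \<epsilon> / (lip_norm \<phi> + 1)"
          using \<open>F \<in> dual_topology e closure_of ?S\<close> unfolding dual_closure by blast
        have "norm (F \<phi>) = norm ((F - G) \<phi>)"
          using G(1) \<phi> by (simp add: const_annihilator_def)
        also have "\<dots> \<le> dual_norm e (F - G) * lip_norm \<phi>"
          using F G(1) S by (intro dual_norm_bound lip_dual_diff \<phi>(1)) auto
        also have "\<dots> \<le> dual_norm e (F - G) * (lip_norm \<phi> + 1)"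
          by (intro mult_left_mono dual_norm_nonneg) simp
        also have "\<dots> \<le> \<epsilon>"
          using G(2) lip_norm_nonneg[OF \<phi>(1)] by (simp add: pos_less_divide_eq)
        finally show "norm (F \<phi>) \<le> 0 + \<epsilon>" by simp
      qed
      then show ?thesis by simp
    qed
    ultimately show ?thesis using that by (auto simp: const_annihilator_def)
  qed
  then show ?thesis
    using S by (simp add: subset_iff flip: closure_of_subset_eq top)
qed

text \<open>Precomposition with \<open>f\<close> preserves constancy on \<open>A\<close> because
  \<open>f\<close> maps \<open>A\<close> into itself; subtracting \<open>\<phi> (f e)\<close> merely
  shifts the constant.\<close>

lemma free_operator_const_annihilator:
  fixes f :: "'a::metric_space \<Rightarrow> 'a"
  assumes f: "\<exists>C. C-lipschitz_on UNIV f" and A: "f ` A \<subseteq> A"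
    and F: "F \<in> (const_annihilator e A :: (('a \<Rightarrow> 'k::real_normed_field) \<Rightarrow> 'k) set)"
  shows "free_operator f e F \<in> const_annihilator e A"
proof -
  have F': "F \<in> free_space e" using F by (simp add: const_annihilator_def)
  moreover have "F (\<lambda>x. \<phi> (f x) - \<phi> (f e)) = 0" if \<phi>: "\<phi> \<in> Lip0 e" "\<phi> constant_on A" for \<phi>
  proof -
    have "(\<lambda>x. \<phi> (f x) - \<phi> (f e)) \<in> Lip0 e" using f Lip0_comp(1)[OF _ \<phi>(1)] by blast
    moreover obtain c where "\<And>x. x \<in> A \<Longrightarrow> \<phi> x = c"
      using \<phi>(2) by (auto simp: constant_on_def)
    with A have "(\<lambda>x. \<phi> (f x) - \<phi> (f e)) constant_on A"
      by (auto simp: constant_on_def image_subset_iff intro!: exI[of _ "c - \<phi> (f e)"])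
    ultimately show ?thesis using F by (auto simp: const_annihilator_def)
  qed
  ultimately show ?thesis
    using free_operator(1)[OF f, of e, where 'k = 'k] free_operator_apply[OF f F']
    by (auto simp: const_annihilator_def bounded_operator_def)
qed

lemma nontrivial_const_annihilator:
  fixes f :: "'a::metric_space \<Rightarrow> 'a"
  assumes f: "\<exists>C. C-lipschitz_on UNIV f"
    and A: "closed A" "A \<noteq> UNIV" "f ` A \<subseteq> A" and ab: "a \<in> A" "b \<in> A" "a \<noteq> b"
  shows "nontrivial_invariant_subspace e (free_operator f e)
    (const_annihilator e A :: (('a \<Rightarrow> 'k::real_normed_field) \<Rightarrow> 'k) set)"
    (is "nontrivial_invariant_subspace e _ ?S")
proof -
  have free: "delta e y - delta e z \<in> free_space e" for y z
    by (rule fvec.subspace_diff[OF free_space_subspace]) (rule delta_free_space)+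
  have "delta e a - delta e b \<in> ?S"
    using ab(1,2) free[of a b]
    by (auto simp: const_annihilator_def delta_def constant_on_def)
  moreover have "delta e a - delta e b \<noteq> (0 :: ('a \<Rightarrow> 'k) \<Rightarrow> 'k)"
  proof
    \<comment> \<open>The distance to \<open>a\<close>, normalised at \<open>e\<close>, separates
      \<open>a\<close> from \<open>b\<close>.\<close>
    define \<phi> where "\<phi> = (\<lambda>y. of_real (infdist y {a} - infdist e {a}) :: 'k)"
    have "\<phi> \<in> Lip0 e"
      unfolding \<phi>_def by (rule of_real_lipschitz_in_Lip0[OF infdist_lipschitz])
    moreover assume "delta e a - delta e b = (0 :: ('a \<Rightarrow> 'k) \<Rightarrow> 'k)"
    then have "(delta e a - delta e b) \<phi> = 0" by simp
    ultimately show False using ab(3) by (simp add: delta_def \<phi>_def)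
  qed
  ultimately have nonzero: "{0} \<subset> ?S"
    using fvec.subspace_0[OF subspace_const_annihilator] by blast
  obtain y where y: "y \<notin> A" using A(2) by blast
  have "delta e y - delta e a \<notin> ?S"
  proof
    \<comment> \<open>The normalised distance to \<open>A\<close> is constant on \<open>A\<close>
      and, as \<open>A\<close> is closed, takes another value at \<open>y\<close>.\<close>
    define \<phi> where "\<phi> = (\<lambda>y. of_real (infdist y A - infdist e A) :: 'k)"
    have \<phi>: "\<phi> \<in> Lip0 e"
      unfolding \<phi>_def by (rule of_real_lipschitz_in_Lip0[OF infdist_lipschitz])
    moreover have "\<phi> constant_on A"
      by (auto simp: constant_on_def \<phi>_def)
    moreover assume "delta e y - delta e a \<in> ?S"
    ultimately have "(delta e y - delta e a) \<phi> = 0"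
      by (simp add: const_annihilator_def)
    then have "infdist y A = 0"
      using \<phi> ab(1) by (simp add: delta_def \<phi>_def)
    then show False
      using in_closed_iff_infdist_zero[OF A(1), of y] ab(1) y by blast
  qed
  moreover have "?S \<subseteq> free_space e" by (auto simp: const_annihilator_def)
  ultimately have proper: "?S \<subset> free_space e"
    using free[of y a] by blast
  show ?thesis
    unfolding nontrivial_invariant_subspace_def
    using nonzero proper free_operator_const_annihilator[OF f A(3)]
    by (auto simp: subspace_const_annihilator closedin_subset_topspace
        closedin_const_annihilator)
qed

theorem theorem4p3:
  fixes f :: "'a::complete_space \<Rightarrow> 'a" and x e :: 'a and r :: real
  assumes "\<not> compact (UNIV :: 'a set)"
    and "\<exists>C. C-lipschitz_on UNIV f"
    and "r > 0" and "compact (cball x r)"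
  shows "(\<exists>S :: (('a \<Rightarrow> real) \<Rightarrow> real) set.
            nontrivial_invariant_subspace e (free_operator f e) S) \<and>
         (\<exists>S :: (('a \<Rightarrow> complex) \<Rightarrow> complex) set.
            nontrivial_invariant_subspace e (free_operator f e) S)"
proof -
  have "continuous_on UNIV f"
    using assms(2) lipschitz_on_continuous_on by blast
  then obtain A a b where "closed A" "A \<noteq> UNIV" "f ` A \<subseteq> A" "a \<in> A" "b \<in> A" "a \<noteq> b"
    using ex_closed_invariant_set[OF assms(1) _ assms(3,4)] by metis
  \<comment> \<open>The scalar field stays schematic: the set \<open>A\<close> depends only on the
    dynamics, so it serves both fields.\<close>
  note A = nontrivial_const_annihilator[OF assms(2) this, of e]
  show ?thesis
    using A[where 'k = real] A[where 'k = complex] by blast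
qed

end
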